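(* Let $\mathcal{G}=(V,E)$ be a finite undirected graph with line graph $\widetilde{\mathcal{G}}=(\widetilde V,\widetilde E)$, where $\widetilde V$ is identified with $E$. Let $\gamma_0,\gamma_1\in(0,\infty)^E$ be two conductivities. Then their associated weighted graph Laplacians on the line graph satisfy $$\widetilde{L}_{\widetilde{\gamma}_1,0}=\operatorname{diag}(\gamma_1/\gamma_0)^{1/2}\;\widetilde{L}_{\widetilde{\gamma}_0,\widetilde q}\;\operatorname{diag}(\gamma_1/\gamma_0)^{1/2},$$ where $\widetilde q\in\mathbb{R}^{E}$ is given by $$\widetilde q=-\bigl(\widetilde{L}_{\widetilde{\gamma}_0,0}\,[(\gamma_1/\gamma_0)^{1/2}]\bigr)\odot\bigl[(\gamma_1/\gamma_0)^{-1/2}\bigr].$$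
   Context: For a finite set $X$, $\mathbb{R}^X$ is the set of functions $X\to\mathbb{R}$. The product $f\odot g$, division and powers of elements of $\mathbb{R}^X$ are componentwise, and $\operatorname{diag}(f)$ is the diagonal operator $u\mapsto f\odot u$ on $\mathbb{R}^X$. Graphs: $\mathcal{G}=(V,E)$ has finite vertex set $V$ and edge set $E\subset\{\{i,j\}: i,j\in V,\ i\neq j\}$. Its line graph $\widetilde{\mathcal{G}}=(\widetilde V,\widetilde E)$ has one vertex per edge of $\mathcal{G}$ (so $\widetilde V=E$), and two distinct $e,e'\in E$ are joined by an edge $\{e,e'\}\in\widetilde E$ if and only if $e$ and $e'$ share a node of $\mathcal{G}$. Line graph conductivity: for $\gamma\in(0,\infty)^E$, define $\widetilde\gamma\in(0,\infty)^{\widetilde E}$ by $\widetilde\gamma(\{e,e'\})=\sqrt{\gamma(e)\gamma(e')}$. Discrete Schrödinger operator on the line graph: for $\widetilde q\in\mathbb{R}^{\widetilde V}=\mathbb{R}^E$, the linear operator $\widetilde L_{\widetilde\gamma,\widetilde q}:\mathbb{R}^{E}\to\mathbb{R}^{E}$ is $$\widetilde L_{\widetilde\gamma,\widetilde q}\,u=\widetilde D^*[\widetilde\gamma\odot(\widetilde D u)]+\widetilde q\odot u,$$ where $\widetilde D:\mathbb{R}^{\widetilde V}\to\mathbb{R}^{\widetilde E}$ is the discrete gradient $(\widetilde D u)(\{e,e'\})=u(e)-u(e')$ (with an arbitrary fixed sign convention for each edge) and $\widetilde D^*$ is its adjoint. Explicitly, $$(\widetilde L_{\widetilde\gamma,\widetilde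 q}\,u)(e)=\sum_{e':\{e,e'\}\in\widetilde E}\widetilde\gamma(\{e,e'\})\,(u(e)-u(e'))+\widetilde q(e)u(e).$$ The case $\widetilde q=0$ is the weighted graph Laplacian on the line graph. *)

theory Defs
  imports Complex_Main "HOL-Library.FuncSet"
begin

text \<open>
  The space of real functions on a set \<open>X\<close> is represented by the functions that are
  \<open>undefined\<close> outside \<open>X\<close>, so that equality of its elements is plain HOL equality.
  The set \<open>X\<close> is therefore an argument of the componentwise operations.
\<close>

abbreviation real_funs :: "'x set \<Rightarrow> ('x \<Rightarrow> real) set" where
  "real_funs X \<equiv> X \<rightarrow>\<^sub>E UNIV"

abbreviation pos_funs :: "'x set \<Rightarrow> ('x \<Rightarrow> real) set" where
  "pos_funs X \<equiv> X \<rightarrow>\<^sub>E {0<..}"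

definition fzero :: "'x set \<Rightarrow> 'x \<Rightarrow> real" where
  "fzero X = (\<lambda>x\<in>X. 0)"

definition fadd :: "'x set \<Rightarrow> ('x \<Rightarrow> real) \<Rightarrow> ('x \<Rightarrow> real) \<Rightarrow> 'x \<Rightarrow> real" where
  "fadd X f g = (\<lambda>x\<in>X. f x + g x)"

definition fneg :: "'x set \<Rightarrow> ('x \<Rightarrow> real) \<Rightarrow> 'x \<Rightarrow> real" where
  "fneg X f = (\<lambda>x\<in>X. - f x)"

definition fmul :: "'x set \<Rightarrow> ('x \<Rightarrow> real) \<Rightarrow> ('x \<Rightarrow> real) \<Rightarrow> 'x \<Rightarrow> real" where
  "fmul X f g = (\<lambda>x\<in>X. f x * g x)"

definition fdiv :: "'x set \<Rightarrow> ('x \<Rightarrow> real) \<Rightarrow> ('x \<Rightarrow> real) \<Rightarrow> 'x \<Rightarrow> real" where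
  "fdiv X f g = (\<lambda>x\<in>X. f x / g x)"

definition fpowr :: "'x set \<Rightarrow> ('x \<Rightarrow> real) \<Rightarrow> real \<Rightarrow> 'x \<Rightarrow> real" where
  "fpowr X f a = (\<lambda>x\<in>X. f x powr a)"

definition diag :: "'x set \<Rightarrow> ('x \<Rightarrow> real) \<Rightarrow> ('x \<Rightarrow> real) \<Rightarrow> 'x \<Rightarrow> real" where
  "diag X f = (\<lambda>u. fmul X f u)"

definition inner_on :: "'x set \<Rightarrow> ('x \<Rightarrow> real) \<Rightarrow> ('x \<Rightarrow> real) \<Rightarrow> real" where
  "inner_on X f g = (\<Sum>x\<in>X. f x * g x)"

text \<open>The adjoint of \<open>T\<close>, from functions on \<open>X\<close> to functions on \<open>Y\<close>; the library's
  \<open>adjoint\<close> would need the two function spaces to be types.\<close>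

definition adjoint_on ::
  "'x set \<Rightarrow> 'y set \<Rightarrow> (('x \<Rightarrow> real) \<Rightarrow> ('y \<Rightarrow> real)) \<Rightarrow> ('y \<Rightarrow> real) \<Rightarrow> 'x \<Rightarrow> real" where
  "adjoint_on X Y T v =
     (THE w. w \<in> real_funs X \<and> (\<forall>u\<in>real_funs X. inner_on Y (T u) v = inner_on X u w))"

definition finite_graph :: "'a set \<Rightarrow> 'a set set \<Rightarrow> bool" where
  "finite_graph V E \<longleftrightarrow> finite V \<and> E \<subseteq> {{i, j} | i j. i \<in> V \<and> j \<in> V \<and> i \<noteq> j}"

definition line_edges :: "'a set set \<Rightarrow> 'a set set set" where
  "line_edges E = {{e, e'} | e e'. e \<in> E \<and> e' \<in> E \<and> e \<noteq> e' \<and> e \<inter> e' \<noteq> {}}"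

text \<open>An element of \<open>line_edges E\<close> has exactly two elements, so the product below is
  the product of the two conductivities at its ends.\<close>

definition line_cond :: "'a set set \<Rightarrow> ('a set \<Rightarrow> real) \<Rightarrow> 'a set set \<Rightarrow> real" where
  "line_cond E \<gamma> = (\<lambda>d\<in>line_edges E. sqrt (\<Prod>e\<in>d. \<gamma> e))"

text \<open>A sign convention for the gradient: every edge of the line graph is listed as an
  ordered pair of its ends.\<close>

definition line_orientation :: "'a set set \<Rightarrow> ('a set set \<Rightarrow> 'a set \<times> 'a set) \<Rightarrow> bool" where
  "line_orientation E ori \<longleftrightarrow> (\<forall>d\<in>line_edges E. d = {fst (ori d), snd (ori d)})"

definition line_grad ::
  "'a set set \<Rightarrow> ('a set set \<Rightarrow> 'a set \<times> 'a set) \<Rightarrow> ('a set \<Rightarrow> real) \<Rightarrow> 'a set set \<Rightarrow> real" where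
  "line_grad E ori u = (\<lambda>d\<in>line_edges E. u (fst (ori d)) - u (snd (ori d)))"

definition line_schroedinger ::
  "'a set set \<Rightarrow> ('a set set \<Rightarrow> 'a set \<times> 'a set) \<Rightarrow> ('a set set \<Rightarrow> real) \<Rightarrow> ('a set \<Rightarrow> real)
     \<Rightarrow> ('a set \<Rightarrow> real) \<Rightarrow> 'a set \<Rightarrow> real" where
  "line_schroedinger E ori c q u =
     fadd E
       (adjoint_on E (line_edges E) (line_grad E ori)
          (fmul (line_edges E) c (line_grad E ori u)))
       (fmul E q u)"

lemma finite_graph_finite_edges: "finite_graph V E \<Longrightarrow> finite E"
  unfolding finite_graph_def by (rule finite_subset[of _ "Pow V"]) auto

lemma finite_line_edges: "finite E \<Longrightarrow> finite (line_edges E)"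
  unfolding line_edges_def by (rule finite_subset[of _ "Pow E"]) auto

lemma adjoint_on_eqI:
  assumes "finite X" "w \<in> real_funs X"
    and "\<And>u. u \<in> real_funs X \<Longrightarrow> inner_on Y (T u) v = inner_on X u w"
  shows "adjoint_on X Y T v = w"
  unfolding adjoint_on_def
proof (rule the_equality)
  show "w \<in> real_funs X \<and> (\<forall>u\<in>real_funs X. inner_on Y (T u) v = inner_on X u w)"
    using assms by blast
next
  fix w' assume w': "w' \<in> real_funs X \<and>
    (\<forall>u\<in>real_funs X. inner_on Y (T u) v = inner_on X u w')"
  show "w' = w"
  proof (rule extensionalityI[of _ X])
    fix x assume x: "x \<in> X"
    define u where "u = (\<lambda>y\<in>X. if y = x then 1 else 0 :: real)"
    have "u \<in> real_funs X" by (simp add: u_def)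
    then have "inner_on X u w' = inner_on X u w" using w' assms(3) by metis
    moreover have "inner_on X u f = f x" for f
    proof -
      have "inner_on X u f = (\<Sum>y\<in>X. if y = x then f y else 0)"
        unfolding inner_on_def u_def by (rule sum.cong) auto
      then show ?thesis using assms(1) x by simp
    qed
    ultimately show "w' x = w x" by simp
  qed (use w' assms(2) in \<open>auto simp: PiE_def\<close>)
qed

lemma adjoint_line_grad:
  assumes "finite E" and ori: "line_orientation E ori"
  shows "adjoint_on E (line_edges E) (line_grad E ori) v =
    (\<lambda>e\<in>E. \<Sum>d\<in>line_edges E. (if fst (ori d) = e then v d else 0)
                            - (if snd (ori d) = e then v d else 0))"
    (is "_ = ?w")
proof (rule adjoint_on_eqI)
  fix u :: "'a set \<Rightarrow> real"
  have mem: "fst (ori d) \<in> E" "snd (ori d) \<in> E" if "d \<in> line_edges E" for d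
  proof -
    have "d \<subseteq> E" using that by (auto simp: line_edges_def)
    moreover have "d = {fst (ori d), snd (ori d)}"
      using that ori by (simp add: line_orientation_def)
    ultimately show "fst (ori d) \<in> E" "snd (ori d) \<in> E" by blast+
  qed
  have "inner_on E u ?w = (\<Sum>e\<in>E. \<Sum>d\<in>line_edges E.
      (if fst (ori d) = e then u e * v d else 0) - (if snd (ori d) = e then u e * v d else 0))"
    unfolding inner_on_def by (auto simp: sum_distrib_left intro!: sum.cong)
  also have "\<dots> = (\<Sum>d\<in>line_edges E. \<Sum>e\<in>E.
      (if fst (ori d) = e then u e * v d else 0) - (if snd (ori d) = e then u e * v d else 0))"
    by (rule sum.swap)
  also have "\<dots> = inner_on (line_edges E) (line_grad E ori u) v"
    unfolding inner_on_def line_grad_def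
    using assms(1) mem by (intro sum.cong) (auto simp: sum_subtractf left_diff_distrib)
  finally show "inner_on (line_edges E) (line_grad E ori u) v = inner_on E u ?w" by simp
qed (use assms in auto)

text \<open>In particular the operator does not depend on the sign convention.\<close>

lemma line_schroedinger_explicit:
  assumes "finite E" and ori: "line_orientation E ori" and e: "e \<in> E"
  shows "line_schroedinger E ori c q u e =
    (\<Sum>e' | {e, e'} \<in> line_edges E. c {e, e'} * (u e - u e')) + q e * u e"
proof -
  let ?F = "line_edges E"
  let ?v = "fmul ?F c (line_grad E ori u)"
  let ?N = "{e'. {e, e'} \<in> ?F}"
  let ?g = "\<lambda>d. (if fst (ori d) = e then ?v d else 0) - (if snd (ori d) = e then ?v d else 0)"
  have ends: "{fst (ori d), snd (ori d)} = d" if "d \<in> ?F" for d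
    using that ori by (simp add: line_orientation_def)
  have ne: "e \<noteq> e'" if "{e, e'} \<in> ?F" for e'
    using that by (auto simp: line_edges_def doubleton_eq_iff)
  have zero: "?g d = 0" if "d \<in> ?F" "e \<notin> d" for d
    using ends[OF that(1)] that(2) by auto
  have val: "?g {e, e'} = c {e, e'} * (u e - u e')" if F: "{e, e'} \<in> ?F" for e'
  proof -
    have "{fst (ori {e, e'}), snd (ori {e, e'})} = {e, e'}" by (rule ends[OF F])
    then consider "fst (ori {e, e'}) = e" "snd (ori {e, e'}) = e'"
      | "fst (ori {e, e'}) = e'" "snd (ori {e, e'}) = e"
      by (metis doubleton_eq_iff)
    then show ?thesis
      using F ne[OF F] by cases (auto simp: fmul_def line_grad_def algebra_simps)
  qed
  have img: "{d \<in> ?F. e \<in> d} = (\<lambda>e'. {e, e'}) ` ?N"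
    by (auto simp: line_edges_def insert_commute image_iff)
  have "(\<Sum>d\<in>?F. ?g d) = (\<Sum>d\<in>{d \<in> ?F. e \<in> d}. ?g d)"
    by (rule sum.mono_neutral_right) (use assms zero finite_line_edges in auto)
  also have "\<dots> = (\<Sum>e'\<in>?N. ?g {e, e'})"
    unfolding img by (subst sum.reindex) (auto simp: inj_on_def doubleton_eq_iff)
  also have "\<dots> = (\<Sum>e'\<in>?N. c {e, e'} * (u e - u e'))"
    by (rule sum.cong) (use val in auto)
  finally show ?thesis
    using e by (simp add: line_schroedinger_def adjoint_line_grad[OF assms(1) ori] fadd_def)
      (simp add: fmul_def)
qed

end

(* With s = (gamma1/gamma0)^(1/2), the line graph conductivities satisfy
   c1{e,e'} = s(e) c0{e,e'} s(e').  The ground-state identity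
   s(e) u(e) - s(e') u(e') = s(e') (u(e) - u(e')) + u(e) (s(e) - s(e'))
   splits the Laplacian of s u into the Laplacian with conductivity c1, divided by s,
   and a zeroth-order term that the potential q is chosen to cancel. *)

theory Submission
  imports Defs
begin

text \<open>Each end contributes \<gamma>1 = (\<gamma>1/\<gamma>0) * \<gamma>0, where positivity of
  \<gamma>0 permits the cancellation, and the square root is multiplicative. The ends are distinct,
  so the product over \<open>{e, e'}\<close> really has two factors.\<close>

lemma line_cond_rescale:
  assumes \<gamma>: "\<gamma>\<^sub>0 \<in> pos_funs E" and F: "{e, e'} \<in> line_edges E"
  shows "line_cond E \<gamma>\<^sub>1 {e, e'} =
    sqrt (\<gamma>\<^sub>1 e / \<gamma>\<^sub>0 e) * line_cond E \<gamma>\<^sub>0 {e, e'} * sqrt (\<gamma>\<^sub>1 e' / \<gamma>\<^sub>0 e')"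
proof -
  have mem: "e \<in> E" "e' \<in> E" "e \<noteq> e'"
    using F by (auto simp: line_edges_def doubleton_eq_iff)
  then have "\<gamma>\<^sub>0 e > 0" "\<gamma>\<^sub>0 e' > 0"
    using \<gamma> by (auto simp: PiE_iff)
  then show ?thesis
    using mem F by (simp add: line_cond_def real_sqrt_mult real_sqrt_divide)
qed

text \<open>The potential enters only through the product \<open>q e * s e\<close>, so the argument
  at the vertex \<open>e\<close> involves no division by \<open>s\<close>.\<close>

lemma line_schroedinger_conjugate:
  assumes fin: "finite E" and ori: "line_orientation E ori" and e: "e \<in> E"
    and c: "\<And>e'. {e, e'} \<in> line_edges E \<Longrightarrow> c\<^sub>1 {e, e'} = s e * c\<^sub>0 {e, e'} * s e'"
    and q: "q e * s e = - line_schroedinger E ori c\<^sub>0 (fzero E) s e"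
  shows "line_schroedinger E ori c\<^sub>1 (fzero E) u e =
    s e * line_schroedinger E ori c\<^sub>0 q (fmul E s u) e"
proof -
  let ?N = "{e'. {e, e'} \<in> line_edges E}"
  note expl = line_schroedinger_explicit[OF fin ori e]
  \<comment> \<open>Neighbours must lie in \<open>E\<close> for \<open>fmul E s u\<close> to take
    the value \<open>s e' * u e'\<close> there; outside \<open>E\<close> it is
    \<open>undefined\<close>.\<close>
  have mem: "e' \<in> E" if "e' \<in> ?N" for e'
    using that by (auto simp: line_edges_def doubleton_eq_iff)
  have "q e * s e = - (\<Sum>e'\<in>?N. c\<^sub>0 {e, e'} * (s e - s e'))"
    using q e by (simp add: expl fzero_def)
  \<comment> \<open>Multiplying by \<open>u e\<close> turns the potential term into a sum over the
    same neighbours as the Laplacian, so the two can be merged termwise.\<close>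
  then have pot: "q e * (s e * u e) = - (\<Sum>e'\<in>?N. c\<^sub>0 {e, e'} * (s e - s e') * u e)"
    by (simp add: sum_distrib_right flip: mult.assoc)
  have "line_schroedinger E ori c\<^sub>0 q (fmul E s u) e =
      (\<Sum>e'\<in>?N. c\<^sub>0 {e, e'} * (s e * u e - s e' * u e')) + q e * (s e * u e)"
    unfolding expl using e mem by (simp add: fmul_def)
  also have "\<dots> = (\<Sum>e'\<in>?N. c\<^sub>0 {e, e'} * s e' * (u e - u e'))"
    unfolding pot by (simp add: algebra_simps flip: sum_subtractf)
  \<comment> \<open>The outer factor \<open>s e\<close> completes
    \<open>c\<^sub>0 {e, e'} * s e'\<close> to \<open>c\<^sub>1 {e, e'}\<close>.\<close>
  finally show ?thesis
    using e c by (simp add: expl fzero_def sum_distrib_left mult.assoc)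
qed

theorem theorem3p2:
  fixes V :: "'a set" and E :: "'a set set"
    and ori :: "'a set set \<Rightarrow> 'a set \<times> 'a set"
    and \<gamma>\<^sub>0 \<gamma>\<^sub>1 q :: "'a set \<Rightarrow> real"
  assumes "finite_graph V E"
    and "line_orientation E ori"
    and "\<gamma>\<^sub>0 \<in> pos_funs E" and "\<gamma>\<^sub>1 \<in> pos_funs E"
    and "q = fmul E
               (fneg E (line_schroedinger E ori (line_cond E \<gamma>\<^sub>0) (fzero E)
                         (fpowr E (fdiv E \<gamma>\<^sub>1 \<gamma>\<^sub>0) (1/2))))
               (fpowr E (fdiv E \<gamma>\<^sub>1 \<gamma>\<^sub>0) (-1/2))"
  shows "\<forall>u\<in>real_funs E.
           line_schroedinger E ori (line_cond E \<gamma>\<^sub>1) (fzero E) u =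
           diag E (fpowr E (fdiv E \<gamma>\<^sub>1 \<gamma>\<^sub>0) (1/2))
             (line_schroedinger E ori (line_cond E \<gamma>\<^sub>0) q
               (diag E (fpowr E (fdiv E \<gamma>\<^sub>1 \<gamma>\<^sub>0) (1/2)) u))"
proof
  fix u assume "u \<in> real_funs E"
  define s where "s = fpowr E (fdiv E \<gamma>\<^sub>1 \<gamma>\<^sub>0) (1/2)"
  have fin: "finite E"
    using assms(1) by (rule finite_graph_finite_edges)
  have pos: "\<gamma>\<^sub>0 e > 0" "\<gamma>\<^sub>1 e > 0" if "e \<in> E" for e
    using assms(3,4) that by (auto simp: PiE_iff)
  have s: "s e = sqrt (\<gamma>\<^sub>1 e / \<gamma>\<^sub>0 e)" if "e \<in> E" for e
    using that pos[OF that] by (simp add: s_def fpowr_def fdiv_def powr_half_sqrt)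
  \<comment> \<open>The ratio is positive, so the exponents -1/2 and 1/2 add up to the power 0,
    which is 1.\<close>
  have inv: "fpowr E (fdiv E \<gamma>\<^sub>1 \<gamma>\<^sub>0) (-1/2) e * s e = 1" if "e \<in> E" for e
    using that pos[OF that] by (simp add: s_def fpowr_def fdiv_def flip: powr_add)
  have q: "q e * s e = - line_schroedinger E ori (line_cond E \<gamma>\<^sub>0) (fzero E) s e"
    if "e \<in> E" for e
    using that inv[OF that] unfolding assms(5) s_def[symmetric]
    by (simp add: fmul_def fneg_def mult.assoc)
  have c: "line_cond E \<gamma>\<^sub>1 {e, e'} = s e * line_cond E \<gamma>\<^sub>0 {e, e'} * s e'"
    if "{e, e'} \<in> line_edges E" for e e'
  proof -
    have "e \<in> E" "e' \<in> E"
      using that by (auto simp: line_edges_def doubleton_eq_iff)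
    then show ?thesis
      using line_cond_rescale[OF assms(3) that, of \<gamma>\<^sub>1] by (simp add: s)
  qed
  have "line_schroedinger E ori (line_cond E \<gamma>\<^sub>1) (fzero E) u =
      fmul E s (line_schroedinger E ori (line_cond E \<gamma>\<^sub>0) q (fmul E s u))"
  \<comment> \<open>Both sides are \<open>undefined\<close> off \<open>E\<close>, so equality of
    functions reduces to equality at each edge.\<close>
  proof (rule extensionalityI[of _ E])
    fix e assume e: "e \<in> E"
    have "line_schroedinger E ori (line_cond E \<gamma>\<^sub>1) (fzero E) u e =
        s e * line_schroedinger E ori (line_cond E \<gamma>\<^sub>0) q (fmul E s u) e"
      using fin assms(2) e c q[OF e] by (rule line_schroedinger_conjugate)
    then show "line_schroedinger E ori (line_cond E \<gamma>\<^sub>1) (fzero E) u e =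
        fmul E s (line_schroedinger E ori (line_cond E \<gamma>\<^sub>0) q (fmul E s u)) e"
      \<comment> \<open>The instantiation unfolds only the outer product and leaves the inner
        \<open>fmul E s u\<close> as it stands in the previous fact.\<close>
      using e by (simp add: fmul_def[of E s "line_schroedinger E ori c p v" for c p v])
  qed (simp_all add: line_schroedinger_def fadd_def fmul_def)
  then show "line_schroedinger E ori (line_cond E \<gamma>\<^sub>1) (fzero E) u =
      diag E (fpowr E (fdiv E \<gamma>\<^sub>1 \<gamma>\<^sub>0) (1/2))
        (line_schroedinger E ori (line_cond E \<gamma>\<^sub>0) q
          (diag E (fpowr E (fdiv E \<gamma>\<^sub>1 \<gamma>\<^sub>0) (1/2)) u))"
    by (simp only: diag_def s_def)
qed

end
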